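(* Let $\mu$ be a positive finite Borel measure on $\mathbb{C}$, supported on an infinite set, with $0<\int_{\mathbb{C}}|z|^{2m}\,d\mu(z)<+\infty$ for all $m=0,1,2,\ldots$. Let $1\le n\le N$ be integers. Then the $n$-point correlation measure $\Gamma^{(n)}_{\mu,N}$ satisfies $$d\Gamma^{(n)}_{\mu,N}(z_1,\ldots,z_n)=\det\big[K_{\mu,N}(z_j,z_k)\big]_{j,k=1}^n\,d\mu(z_1)\cdots d\mu(z_n).$$
   Context: $P^2_N(\mathbb{C},\mu)$ is the $N$-dimensional space of analytic polynomials (in $z$) of degree $\le N-1$, with the inner product of $L^2(\mathbb{C},\mu)$, and $K_{\mu,N}$ is its reproducing kernel: for each $z\in\mathbb{C}$, $K_{\mu,N}(\cdot,z)\in P^2_N(\mathbb{C},\mu)$ and $p(z)=\int_{\mathbb{C}}p(w)\,\overline{K_{\mu,N}(w,z)}\,d\mu(w)$ for all $p\in P^2_N(\mathbb{C},\mu)$. Equivalently, $K_{\mu,N}(z,w)=\sum_{j=1}^N\phi_j(z)\overline{\phi_j(w)}$ for an orthonormal basis $\phi_1,\ldots,\phi_N$ of $P^2_N(\mathbb{C},\mu)$. Let $\triangle(z_1,\ldots,z_N)=\prod_{1\le j<k\le N}(z_j-z_k)$ and $Z_N=\int_{\mathbb{C}^N}|\triangle(z_1,\ldots,z_N)|^2\,d\mu(z_1)\cdots d\mu(z_N)$. The $n$-point correlation measure on $\mathbb{C}^n$ is $$d\Gamma^{(n)}_{\mu,N}(z_1,\ldots,z_n)=\frac{N!}{(N-n)!}\,\frac1{Z_N}\Big\{\int_{\mathbb{C}^{N-n}}|\triangle(z_1,\ldots,z_N)|^2\,d\mu(z_{n+1})\cdots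 d\mu(z_N)\Big\}\,d\mu(z_1)\cdots d\mu(z_n).$$ *)

theory Defs
  imports "HOL-Analysis.Analysis" "HOL-Computational_Algebra.Polynomial"
    "Jordan_Normal_Form.Determinant"
begin

definition measure_support :: "complex measure \<Rightarrow> complex set" where
  "measure_support \<mu> = {z. \<forall>U. open U \<longrightarrow> z \<in> U \<longrightarrow> 0 < emeasure \<mu> U}"

text \<open>The elements of $P^2_N$ are taken as functions on the whole plane, not as classes modulo
  null sets: when \<open>\<mu>\<close> has infinite support, a polynomial is determined by its class. For \<open>N = 0\<close>
  truncated subtraction gives the constants; only \<open>N \<ge> 1\<close> is intended.\<close>

definition poly_space :: "nat \<Rightarrow> (complex \<Rightarrow> complex) set" where
  "poly_space N = poly ` {p. degree p \<le> N - 1}"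

definition is_reproducing_kernel ::
    "complex measure \<Rightarrow> nat \<Rightarrow> (complex \<Rightarrow> complex \<Rightarrow> complex) \<Rightarrow> bool" where
  "is_reproducing_kernel \<mu> N K \<longleftrightarrow>
     (\<forall>z. (\<lambda>w. K w z) \<in> poly_space N \<and>
          (\<forall>p\<in>poly_space N. p z = (\<integral>w. p w * cnj (K w z) \<partial>\<mu>)))"

definition repr_kernel :: "complex measure \<Rightarrow> nat \<Rightarrow> complex \<Rightarrow> complex \<Rightarrow> complex" where
  "repr_kernel \<mu> N = (THE K. is_reproducing_kernel \<mu> N K)"

text \<open>Points of $\mathbb{C}^N$ are functions on the index set \<open>{..<N}\<close>, so the coordinates
  $z_1, \ldots, z_N$ are \<open>z 0, \<dots>, z (N - 1)\<close>. The integration variables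
  $z_{n+1}, \ldots, z_N$ are those with index in \<open>{n..<N}\<close>.\<close>

definition vandermonde :: "nat \<Rightarrow> (nat \<Rightarrow> complex) \<Rightarrow> complex" where
  "vandermonde N z = (\<Prod>k<N. \<Prod>j<k. z j - z k)"

definition partition_fn :: "complex measure \<Rightarrow> nat \<Rightarrow> ennreal" where
  "partition_fn \<mu> N =
     (\<integral>\<^sup>+z. ennreal ((cmod (vandermonde N z))\<^sup>2) \<partial>(\<Pi>\<^sub>M i\<in>{..<N}. \<mu>))"

definition correlation_measure ::
    "complex measure \<Rightarrow> nat \<Rightarrow> nat \<Rightarrow> (nat \<Rightarrow> complex) measure" where
  "correlation_measure \<mu> N n =
     density (\<Pi>\<^sub>M i\<in>{..<n}. \<mu>)
       (\<lambda>z. ennreal (fact N / fact (N - n)) * (1 / partition_fn \<mu> N) *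
            (\<integral>\<^sup>+w. ennreal ((cmod (vandermonde N (merge {..<n} {n..<N} (z, w))))\<^sup>2)
               \<partial>(\<Pi>\<^sub>M i\<in>{n..<N}. \<mu>)))"

text \<open>$d\nu = f\,dM$ for a positive measure \<open>\<nu>\<close> and a complex-valued integrable \<open>f\<close>. The constant
  \<^const>\<open>density\<close> only takes nonnegative functions, and here \<open>f\<close> is not known in advance to be one.
  Integrability and finiteness exclude the cases in which the Bochner integral or
  \<^const>\<open>measure\<close> is 0 by convention.\<close>

definition has_complex_density :: "'a measure \<Rightarrow> 'a measure \<Rightarrow> ('a \<Rightarrow> complex) \<Rightarrow> bool" where
  "has_complex_density \<nu> M f \<longleftrightarrow>
     sets \<nu> = sets M \<and> finite_measure \<nu> \<and> integrable M f \<and>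
     (\<forall>A\<in>sets M. complex_of_real (measure \<nu> A) = (LINT x:A|M. f x))"

end

theory Submission imports Defs
begin

text \<open>Let \<open>\<phi>\<^sub>j\<close>, of degree \<open>j\<close>, be the orthonormal polynomials of \<open>\<mu>\<close>. The reproducing kernel is
  \<open>K(z,w) = \<Sum>j<N. \<phi>\<^sub>j(z) cnj (\<phi>\<^sub>j(w))\<close>, and column operations on the Vandermonde matrix show that
  $|\triangle|^2$ is a constant multiple of the determinant \<open>D\<^sub>N\<close>, where \<open>D\<^sub>m\<close> is the
  determinant of $[K(z_j,z_k)]_{j,k<m}$. Expanding the bordered determinant \<open>D\<^sub>m\<^sub>+\<^sub>1\<close> along its
  last row and column, the reproducing property gives
  $\int D_{m+1}\,d\mu(z_m) = (N-m) D_m$. Starting from \<open>D\<^sub>N\<close> and integrating out one variable at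
  a time yields all marginals, the normalising constant \<open>Z\<^sub>N\<close> included.\<close>

section \<open>Determinants\<close>

text \<open>Laplace expansion along the last row, then of each remaining minor along the border
  column. The point of this form is that the border entries appear only as explicit factors:
  everything else is built from \<open>B\<close>.\<close>

lemma det_bordered:
  fixes A :: "'a::comm_ring_1 mat"
  assumes A: "A \<in> carrier_mat (Suc m) (Suc m)"
  defines "B \<equiv> Matrix.mat m m (\<lambda>(i, j). A $$ (i, j))"
  shows "Determinant.det A = A $$ (m, m) * Determinant.det B
    - (\<Sum>k<m. \<Sum>j<m. A $$ (m, k) * A $$ (j, m) * cofactor B j k)"
proof -
  have last: "cofactor A m m = Determinant.det B"
  proof -
    have "mat_delete A m m = B"
      using A by (intro eq_matI) (auto simp: mat_delete_def B_def)
    then show ?thesis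
      by (simp add: cofactor_def)
  qed
  have row: "cofactor A m k = - (\<Sum>j<m. A $$ (j, m) * cofactor B j k)" if k: "k < m" for k
  proof -
    let ?D = "mat_delete A m k"
    have D: "?D \<in> carrier_mat m m"
      using A by (auto simp: mat_delete_def)
    \<comment> \<open>Deleting column \<open>k < m\<close> shifts the border column to position
      \<open>m - 1\<close>; this odd shift is the source of the minus sign.\<close>
    have sgn: "(-1) ^ (m + k) * (-1) ^ (j + (m - 1)) = - ((-1::'a) ^ (j + k))" for j
      using k by (cases m) (auto simp: minus_one_power_iff)
    have "Determinant.det ?D = (\<Sum>j<m. ?D $$ (j, m - 1) * cofactor ?D j (m - 1))"
      using laplace_expansion_column[OF D, of "m - 1"] k by simp
    also have "\<dots> = (\<Sum>j<m. A $$ (j, m) * ((-1) ^ (j + (m - 1)) * Determinant.det (mat_delete B j k)))"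
    proof (intro sum.cong refl)
      fix j assume "j \<in> {..<m}"
      then have j: "j < m" by simp
      have "?D $$ (j, m - 1) = A $$ (j, m)"
        using A j k by (auto simp: mat_delete_def)
      moreover have "mat_delete ?D j (m - 1) = mat_delete B j k"
        using A j k by (intro eq_matI) (auto simp: mat_delete_def B_def)
      ultimately show "?D $$ (j, m - 1) * cofactor ?D j (m - 1)
          = A $$ (j, m) * ((-1) ^ (j + (m - 1)) * Determinant.det (mat_delete B j k))"
        by (simp add: cofactor_def)
    qed
    finally have "cofactor A m k = (\<Sum>j<m. A $$ (j, m) *
        (((-1) ^ (m + k) * (-1) ^ (j + (m - 1))) * Determinant.det (mat_delete B j k)))"
      by (simp add: cofactor_def sum_distrib_left mult_ac)
    then show ?thesis
      unfolding sgn by (simp add: cofactor_def sum_negf)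
  qed
  have "Determinant.det A = (\<Sum>k<Suc m. A $$ (m, k) * cofactor A m k)"
    by (rule laplace_expansion_row[OF A]) simp
  also have "\<dots> = A $$ (m, m) * Determinant.det B
    - (\<Sum>k<m. \<Sum>j<m. A $$ (m, k) * A $$ (j, m) * cofactor B j k)"
    by (simp add: last row sum_distrib_left sum_negf mult.assoc)
  finally show ?thesis .
qed

text \<open>The evaluation matrix is the Vandermonde matrix times the matrix of coefficients, which
  is upper triangular by the degree bound. This is the matrix form of the column operations.\<close>

lemma det_poly_matrix:
  fixes p :: "nat \<Rightarrow> 'a::comm_ring_1 poly"
  assumes deg: "\<And>j. j < N \<Longrightarrow> degree (p j) \<le> j"
  shows "Determinant.det (Matrix.mat N N (\<lambda>(i, j). poly (p j) (z i)))
    = Determinant.det (Matrix.mat N N (\<lambda>(i, j). z i ^ j)) * (\<Prod>j<N. coeff (p j) j)"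
proof -
  let ?V = "Matrix.mat N N (\<lambda>(i, j). z i ^ j)"
  let ?U = "Matrix.mat N N (\<lambda>(i, j). coeff (p j) i)"
  have "Matrix.mat N N (\<lambda>(i, j). poly (p j) (z i)) = ?V * ?U"
  proof (rule eq_matI)
    fix i j assume "i < dim_row (?V * ?U)" "j < dim_col (?V * ?U)"
    then have ij: "i < N" "j < N" by auto
    have "poly (p j) (z i) = (\<Sum>k<N. z i ^ k * coeff (p j) k)"
      unfolding poly_altdef using deg[of j] ij
      by (intro sum.mono_neutral_cong_left) (auto simp: mult.commute coeff_eq_0)
    then show "Matrix.mat N N (\<lambda>(i, j). poly (p j) (z i)) $$ (i, j) = (?V * ?U) $$ (i, j)"
      using ij by (simp add: scalar_prod_def atLeast0LessThan)
  qed auto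
  moreover have "Determinant.det ?U = (\<Prod>j<N. coeff (p j) j)"
  proof -
    have "Determinant.det ?U = prod_list (diag_mat ?U)"
      by (intro det_upper_triangular[of _ N] upper_triangularI)
        (auto intro!: coeff_eq_0 order.strict_trans1[OF deg])
    then show ?thesis
      by (simp add: prod_list_diag_prod atLeast0LessThan)
  qed
  ultimately show ?thesis
    by (simp add: det_mult[of _ N])
qed

lemma norm_det_vandermonde:
  "cmod (Determinant.det (Matrix.mat N N (\<lambda>(i, j). z i ^ j))) = cmod (vandermonde N z)"
proof -
  \<comment> \<open>The Newton basis at the nodes: being monic, it leaves the determinant unchanged,
    and since \<open>q j\<close> vanishes at \<open>z i\<close> for \<open>i < j\<close>, its
    evaluation matrix is lower triangular. The factors \<open>z k - z j\<close> that result agree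
    with those of \<open>vandermonde\<close> up to sign, hence the moduli.\<close>
  define q where "q j = (\<Prod>k<j. [:- z k, 1:])" for j
  have deg: "degree (q j) = j" for j
    unfolding q_def by (subst degree_prod_eq_sum_degree) auto
  have "lead_coeff (q j) = 1" for j
    unfolding q_def by (simp add: lead_coeff_prod)
  then have coeff: "coeff (q j) j = 1" for j
    using deg by metis
  let ?Q = "Matrix.mat N N (\<lambda>(i, j). poly (q j) (z i))"
  have "Determinant.det (Matrix.mat N N (\<lambda>(i, j). z i ^ j)) = Determinant.det ?Q"
    by (subst det_poly_matrix) (simp_all add: deg coeff)
  also have "\<dots> = prod_list (diag_mat ?Q)"
    by (rule det_lower_triangular[of N]) (auto simp: q_def poly_prod)
  also have "\<dots> = (\<Prod>k<N. \<Prod>j<k. z k - z j)"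
    by (simp add: prod_list_diag_prod q_def poly_prod atLeast0LessThan)
  finally show ?thesis
    by (simp add: vandermonde_def norm_minus_commute flip: prod_norm)
qed

text \<open>The matrix is P P* with P the evaluation matrix (rows are points, columns are
  polynomials), so its determinant is |det P|^2.\<close>

lemma det_gram_square:
  assumes "\<And>j. j < N \<Longrightarrow> degree (p j) \<le> j"
  shows "Determinant.det (Matrix.mat N N (\<lambda>(j, k). \<Sum>l<N. poly (p l) (z j) * cnj (poly (p l) (z k))))
    = of_real ((\<Prod>j<N. (cmod (coeff (p j) j))\<^sup>2) * (cmod (vandermonde N z))\<^sup>2)"
proof -
  interpret cnj: comm_ring_hom cnj
    by unfold_locales auto
  let ?P = "Matrix.mat N N (\<lambda>(i, j). poly (p j) (z i))"
  have "Matrix.mat N N (\<lambda>(j, k). \<Sum>l<N. poly (p l) (z j) * cnj (poly (p l) (z k)))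
      = ?P * transpose_mat (map_mat cnj ?P)"
    by (rule eq_matI) (auto simp: scalar_prod_def atLeast0LessThan)
  then have "Determinant.det (Matrix.mat N N (\<lambda>(j, k). \<Sum>l<N. poly (p l) (z j) * cnj (poly (p l) (z k))))
      = Determinant.det ?P * cnj (Determinant.det ?P)"
    by (simp add: det_mult[of _ N] det_transpose[of _ N])
  also have "\<dots> = of_real ((cmod (Determinant.det ?P))\<^sup>2)"
    by (rule complex_norm_square[symmetric])
  also have "cmod (Determinant.det ?P) = cmod (vandermonde N z) * (\<Prod>j<N. cmod (coeff (p j) j))"
    by (subst det_poly_matrix) (simp_all add: assms norm_mult norm_det_vandermonde prod_norm)
  finally show ?thesis
    by (simp add: power_mult_distrib prod_power_distrib mult.commute)
qed

section \<open>Orthonormal polynomials\<close>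

locale moment_measure = finite_measure \<mu> for \<mu> :: "complex measure" +
  assumes sets_eq [measurable_cong, simp]: "sets \<mu> = sets borel"
    and infinite_support: "infinite (measure_support \<mu>)"
    and moments: "(\<integral>\<^sup>+z. ennreal (cmod z ^ (2 * m)) \<partial>\<mu>) < \<infinity>"
begin

lemma borel_measurable_poly [measurable]: "poly p \<in> borel_measurable \<mu>"
proof -
  have "poly p \<in> borel_measurable borel"
    by (intro borel_measurable_continuous_onI continuous_intros)
  then show ?thesis
    by (simp cong: measurable_cong_sets)
qed

lemma integrable_monomial: "integrable \<mu> (\<lambda>z. z ^ i * cnj (z ^ j))"
\<comment> \<open>Only even moments are given, so |z|^(i+j) is dominated by 1 + |z|^(2(i+j)); the
  constant is integrable because \<open>\<mu>\<close> is finite.\<close>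
proof (rule Bochner_Integration.integrable_bound)
  have "integrable \<mu> (\<lambda>z. cmod z ^ (2 * (i + j)))"
    using moments[of "i + j"] by (intro integrableI_nonneg) (auto cong: measurable_cong_sets)
  then show "integrable \<mu> (\<lambda>z. 1 + cmod z ^ (2 * (i + j)))"
    by simp
  show "(\<lambda>z. z ^ i * cnj (z ^ j)) \<in> borel_measurable \<mu>"
    unfolding measurable_cong_sets[OF sets_eq refl]
    by (intro borel_measurable_continuous_onI continuous_intros)
  have bound: "x ^ k \<le> 1 + x ^ (2 * k)" for x :: real and k
  proof -
    have "0 \<le> (x ^ k - 1)\<^sup>2 + (x ^ k)\<^sup>2 + 1"
      by (intro add_nonneg_nonneg) auto
    then show ?thesis
      by (simp add: power2_eq_square algebra_simps power_mult power_even_eq)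
  qed
  then show "AE z in \<mu>. norm (z ^ i * cnj (z ^ j)) \<le> norm (1 + cmod z ^ (2 * (i + j)))"
    using bound[of _ "i + j"] by (intro AE_I2) (simp add: norm_mult norm_power flip: power_add)
qed

lemma integrable_poly: "integrable \<mu> (\<lambda>z. poly p z * cnj (poly q z))"
proof -
  have "(\<lambda>z. poly p z * cnj (poly q z))
    = (\<lambda>z. \<Sum>i\<le>degree p. \<Sum>j\<le>degree q. (coeff p i * cnj (coeff q j)) * (z ^ i * cnj (z ^ j)))"
    by (simp add: poly_altdef sum_product mult_ac fun_eq_iff)
  then show ?thesis
    by (simp only:) (intro Bochner_Integration.integrable_sum integrable_mult_right integrable_monomial)
qed

section \<open>The inner product on polynomials and Gram-Schmidt\<close>

definition ip :: "complex poly \<Rightarrow> complex poly \<Rightarrow> complex" where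
  "ip p q = (\<integral>z. poly p z * cnj (poly q z) \<partial>\<mu>)"

lemma ip_add_left: "ip (p + q) r = ip p r + ip q r"
  by (simp add: ip_def distrib_right integrable_poly)

lemma ip_smult_left: "ip (Polynomial.smult a p) r = a * ip p r"
  by (simp add: ip_def mult.assoc)

lemma ip_cnj: "cnj (ip p q) = ip q p"
  using Bochner_Integration.integral_cnj[of \<mu> "\<lambda>z. poly p z * cnj (poly q z)"] by (simp add: ip_def mult.commute)

lemma ip_smult_right: "ip p (Polynomial.smult a r) = cnj a * ip p r"
  by (metis ip_smult_left ip_cnj complex_cnj_mult)

lemma ip_zero_left: "ip 0 r = 0"
  by (simp add: ip_def)

lemma ip_diff_left: "ip (p - q) r = ip p r - ip q r"
  using ip_add_left[of p "Polynomial.smult (-1) q" r] ip_smult_left[of "-1" q r] by simp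

lemma ip_sum_left: "ip (\<Sum>i\<in>A. p i) r = (\<Sum>i\<in>A. ip (p i) r)"
  by (induction A rule: infinite_finite_induct) (simp_all add: ip_zero_left ip_add_left)

lemma ip_self: "ip p p = of_real (\<integral>z. (cmod (poly p z))\<^sup>2 \<partial>\<mu>)"
  by (simp add: ip_def flip: complex_norm_square integral_complex_of_real)

text \<open>Definiteness is where the infinite support enters: a polynomial of norm zero vanishes
  almost everywhere, so the open set where it is nonzero is null and the support lies among its
  roots, which are finitely many unless \<open>p = 0\<close>.\<close>

lemma ip_self_eq_0D:
  assumes "ip p p = 0"
  shows "p = 0"
proof (rule ccontr)
  assume p: "p \<noteq> 0"
  have "integrable \<mu> (\<lambda>z. complex_of_real ((cmod (poly p z))\<^sup>2))"
    using integrable_poly[of p p] by (simp only: complex_norm_square)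
  then have "integrable \<mu> (\<lambda>z. (cmod (poly p z))\<^sup>2)"
    by (simp only: complex_of_real_integrable_eq)
  moreover have "(\<integral>z. (cmod (poly p z))\<^sup>2 \<partial>\<mu>) = 0"
    using assms by (simp add: ip_self)
  ultimately have ae: "AE z in \<mu>. poly p z = 0"
    by (subst (asm) integral_nonneg_eq_0_iff_AE) auto
  let ?U = "{z. poly p z \<noteq> 0}"
  have "open ?U"
    by (intro open_Collect_neq continuous_intros)
  moreover have "emeasure \<mu> ?U = 0"
    using ae \<open>open ?U\<close> by (subst (asm) AE_iff_measurable[of ?U]) (auto simp: sets_eq_imp_space_eq[OF sets_eq])
  ultimately have "measure_support \<mu> \<subseteq> {z. poly p z = 0}"
    unfolding measure_support_def by force
  then show False
    using poly_roots_finite[OF p] infinite_support finite_subset by blast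
qed

text \<open>Gram-Schmidt on the monomials: the monomial of degree N minus its projection onto the
  earlier polynomials is monic of degree N, hence nonzero, and can be normalised.\<close>

lemma ex_orthonormal:
  "\<exists>\<phi>. (\<forall>j<N. degree (\<phi> j) = j) \<and> (\<forall>i<N. \<forall>j<N. ip (\<phi> i) (\<phi> j) = (if i = j then 1 else 0))"
proof (induction N)
  case 0
  show ?case by simp
next
  case (Suc N)
  then obtain \<phi> where deg: "\<And>j. j < N \<Longrightarrow> degree (\<phi> j) = j"
    and orth: "\<And>i j. i < N \<Longrightarrow> j < N \<Longrightarrow> ip (\<phi> i) (\<phi> j) = (if i = j then 1 else 0)"
    by blast
  let ?x = "monom 1 N :: complex poly"
  define s where "s = (\<Sum>i<N. Polynomial.smult (ip ?x (\<phi> i)) (\<phi> i))"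
  define q where "q = ?x - s"
  \<comment> \<open>Stated through coefficients instead of a strict degree bound, so that
    \<open>N = 0\<close>, where \<open>s = 0\<close>, is covered.\<close>
  have "coeff s k = 0" if "N \<le> k" for k
    using that deg unfolding s_def coeff_sum by (intro sum.neutral) (auto simp: coeff_eq_0)
  then have cq: "coeff q N = 1" "\<And>k. N < k \<Longrightarrow> coeff q k = 0"
    by (auto simp: q_def)
  then have degq: "degree q = N"
    by (intro antisym degree_le le_degree) auto
  have q0: "ip q (\<phi> j) = 0" if "j < N" for j
    using that by (simp add: q_def s_def ip_diff_left ip_sum_left ip_smult_left orth if_distrib cong: if_cong)
  define h where "h = (\<integral>z. (cmod (poly q z))\<^sup>2 \<partial>\<mu>)"
  have hq: "ip q q = of_real h"
    by (simp add: ip_self h_def)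
  have "q \<noteq> 0"
    using cq by auto
  then have "h \<noteq> 0"
    using ip_self_eq_0D[of q] hq by auto
  moreover have "h \<ge> 0"
    by (simp add: h_def)
  ultimately have h: "h > 0" by simp
  define u where "u = Polynomial.smult (of_real (1 / sqrt h)) q"
  have "ip u u = 1"
  proof -
    have "ip u u = of_real ((1 / sqrt h) * (1 / sqrt h) * h)"
      by (simp only: u_def ip_smult_left ip_smult_right hq complex_cnj_complex_of_real of_real_mult mult.assoc)
    then show ?thesis
      using h by simp
  qed
  moreover have "degree u = N"
    using h by (simp add: u_def degq)
  moreover have u0: "ip u (\<phi> j) = 0" if "j < N" for j
    using q0[OF that] by (simp add: u_def ip_smult_left)
  moreover have "ip (\<phi> j) u = 0" if "j < N" for j
    using u0[OF that] ip_cnj[of u "\<phi> j"] by simp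
  ultimately have "(\<forall>j<Suc N. degree ((\<phi>(N := u)) j) = j) \<and> (\<forall>i<Suc N. \<forall>j<Suc N.
      ip ((\<phi>(N := u)) i) ((\<phi>(N := u)) j) = (if i = j then 1 else 0))"
    using deg orth by (auto simp: less_Suc_eq)
  then show ?case by blast
qed

text \<open>Uniqueness, needed to evaluate the definite description: the difference of the sections
  of two kernels at \<open>z\<close> is itself a polynomial of the space, and testing both
  reproducing formulas on it shows that its norm is zero.\<close>

lemma repr_kernel_eqI:
  assumes "is_reproducing_kernel \<mu> N K"
  shows "repr_kernel \<mu> N = K"
  unfolding repr_kernel_def
proof (rule the_equality)
  fix K' assume K': "is_reproducing_kernel \<mu> N K'"
  show "K' = K"
  proof (intro ext)
    fix x z
    have mem: "(\<lambda>w. K w z) \<in> poly_space N" "(\<lambda>w. K' w z) \<in> poly_space N"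
      using assms K' by (simp_all add: is_reproducing_kernel_def)
    obtain p where p: "degree p \<le> N - 1" "(\<lambda>w. K w z) = poly p"
      using mem(1) by (auto simp: poly_space_def)
    obtain q where q: "degree q \<le> N - 1" "(\<lambda>w. K' w z) = poly q"
      using mem(2) by (auto simp: poly_space_def)
    let ?r = "p - q"
    have r: "poly ?r \<in> poly_space N"
      using p q by (auto simp: poly_space_def intro: degree_diff_le)
    have "poly ?r z = (\<integral>w. poly ?r w * cnj (K w z) \<partial>\<mu>)"
      using r assms unfolding is_reproducing_kernel_def by blast
    moreover have "poly ?r z = (\<integral>w. poly ?r w * cnj (K' w z) \<partial>\<mu>)"
      using r K' unfolding is_reproducing_kernel_def by blast
    ultimately have "ip p ?r = ip q ?r"
      unfolding fun_cong[OF p(2)] fun_cong[OF q(2)] ip_def[symmetric]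
      using ip_cnj[of ?r p] ip_cnj[of ?r q] by simp
    then have "ip ?r ?r = 0"
      by (simp add: ip_diff_left)
    then show "K' x z = K x z"
      using ip_self_eq_0D[of ?r] fun_cong[OF p(2)] fun_cong[OF q(2)] by simp
  qed
qed (rule assms)

end

section \<open>Correlation measures\<close>

text \<open>Passes from a nonnegative \<open>ennreal\<close> density to the complex notion:
  finiteness of the total integral gives integrability, and for nonnegative integrands the Bochner
  and the nonnegative integral agree.\<close>

lemma has_complex_density_density:
  fixes f :: "'a \<Rightarrow> real"
  assumes f [measurable]: "f \<in> borel_measurable M"
    and nonneg: "\<And>x. x \<in> space M \<Longrightarrow> 0 \<le> f x"
    and finite: "(\<integral>\<^sup>+x. ennreal (f x) \<partial>M) < \<infinity>"
  shows "has_complex_density (density M (\<lambda>x. ennreal (f x))) M (\<lambda>x. complex_of_real (f x))"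
proof -
  let ?D = "density M (\<lambda>x. ennreal (f x))"
  have "finite_measure ?D"
  proof
    have "emeasure ?D (space ?D) = (\<integral>\<^sup>+x. ennreal (f x) \<partial>M)"
      by (simp add: emeasure_density cong: nn_integral_cong)
    then show "emeasure ?D (space ?D) \<noteq> \<infinity>"
      using finite by simp
  qed
  moreover have "integrable M f"
    using nonneg finite by (intro integrableI_nonneg) auto
  moreover have "complex_of_real (measure ?D A) = (LINT x:A|M. complex_of_real (f x))"
    if [measurable]: "A \<in> sets M" for A
  proof -
    have "measure ?D A = enn2real (\<integral>\<^sup>+x. ennreal (indicator A x * f x) \<partial>M)"
      by (simp add: measure_def emeasure_density)
        (auto intro!: arg_cong[where f = enn2real] nn_integral_cong split: split_indicator)
    also have "\<dots> = (\<integral>x. indicator A x * f x \<partial>M)"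
      using nonneg by (subst integral_eq_nn_integral) (auto intro!: AE_I2 split: split_indicator)
    finally show ?thesis
      by (simp add: set_lebesgue_integral_def scaleR_conv_of_real flip: integral_complex_of_real)
  qed
  ultimately show ?thesis
    by (simp add: has_complex_density_def)
qed

lemma vandermonde_cong:
  assumes "\<And>i. i < N \<Longrightarrow> z i = w i"
  shows "vandermonde N z = vandermonde N w"
  unfolding vandermonde_def by (intro prod.cong refl) (auto simp: assms)

lemma borel_measurable_vandermonde:
  assumes "\<And>i. i < N \<Longrightarrow> (\<lambda>x. g x i) \<in> borel_measurable M"
  shows "(\<lambda>x. vandermonde N (g x)) \<in> borel_measurable M"
  unfolding vandermonde_def
  by (intro borel_measurable_prod borel_measurable_diff assms) auto

section \<open>Expansion in orthonormal polynomials and the kernel\<close>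

locale orthonormal_polys = moment_measure \<mu> for \<mu> :: "complex measure" +
  fixes \<phi> :: "nat \<Rightarrow> complex poly" and N :: nat
  assumes deg: "j < N \<Longrightarrow> degree (\<phi> j) = j"
    and orth: "i < N \<Longrightarrow> j < N \<Longrightarrow> ip (\<phi> i) (\<phi> j) = (if i = j then 1 else 0)"
begin

sublocale prod: product_sigma_finite "\<lambda>_::nat. \<mu>"
  by unfold_locales

lemma phi_nonzero: "j < N \<Longrightarrow> \<phi> j \<noteq> 0"
  using orth[of j j] by (auto simp: ip_zero_left)

lemma leading_nonzero: "j < N \<Longrightarrow> coeff (\<phi> j) j \<noteq> 0"
  using phi_nonzero[of j] deg[of j] by (metis leading_coeff_0_iff)

lemma poly_expansion:
  assumes "degree p < N"
  shows "p = (\<Sum>j<N. Polynomial.smult (ip p (\<phi> j)) (\<phi> j))"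
proof -
  \<comment> \<open>First only some coefficients, found by eliminating the leading terms from the
    top down; orthonormality then identifies them as inner products.\<close>
  have "\<exists>c. p = (\<Sum>j<k. Polynomial.smult (c j) (\<phi> j))" if "k \<le> N" "\<And>i. k \<le> i \<Longrightarrow> coeff p i = 0" for k p
    using that
  proof (induction k arbitrary: p)
    case 0
    then have "p = 0" by (intro poly_eqI) auto
    then show ?case by simp
  next
    case (Suc k)
    define a where "a = coeff p k / coeff (\<phi> k) k"
    have "coeff (p - Polynomial.smult a (\<phi> k)) i = 0" if "k \<le> i" for i
    proof (cases "i = k")
      case True
      then show ?thesis
        using Suc.prems leading_nonzero[of k] by (simp add: a_def)
    next
      case False
      then show ?thesis
        using Suc.prems that deg[of k] by (simp add: coeff_eq_0)
    qed
    then obtain c where "p - Polynomial.smult a (\<phi> k) = (\<Sum>j<k. Polynomial.smult (c j) (\<phi> j))"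
      using Suc.IH[of "p - Polynomial.smult a (\<phi> k)"] Suc.prems by auto
    then have "p = (\<Sum>j<Suc k. Polynomial.smult ((c(k := a)) j) (\<phi> j))"
      by (simp add: algebra_simps)
    then show ?case by blast
  qed
  from this[of N p] assms obtain c where c: "p = (\<Sum>j<N. Polynomial.smult (c j) (\<phi> j))"
    by (auto simp: coeff_eq_0)
  have "ip p (\<phi> j) = c j" if "j < N" for j
    using that by (subst c) (simp add: ip_sum_left ip_smult_left orth if_distrib cong: if_cong)
  with c show ?thesis by simp
qed

definition cd_kernel :: "complex \<Rightarrow> complex \<Rightarrow> complex" where
  "cd_kernel z w = (\<Sum>j<N. poly (\<phi> j) z * cnj (poly (\<phi> j) w))"

text \<open>The section of the kernel at \<open>w\<close> as a polynomial, so that \<open>ip\<close>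
  and degree bounds apply to it.\<close>

definition kernel_poly :: "complex \<Rightarrow> complex poly" where
  "kernel_poly w = (\<Sum>j<N. Polynomial.smult (cnj (poly (\<phi> j) w)) (\<phi> j))"

lemma poly_kernel_poly: "poly (kernel_poly w) z = cd_kernel z w"
  by (simp add: kernel_poly_def cd_kernel_def poly_sum mult.commute)

lemma cnj_kernel: "cnj (cd_kernel z w) = cd_kernel w z"
  by (simp add: cd_kernel_def mult.commute)

lemma degree_kernel_poly: "degree (kernel_poly w) \<le> N - 1"
  unfolding kernel_poly_def by (intro degree_sum_le) (auto simp: deg)

lemma ip_kernel_poly:
  assumes "degree p < N"
  shows "ip p (kernel_poly z) = poly p z"
proof -
  \<comment> \<open>The arguments are swapped because additivity is available in the left one;
    conjugating back yields the orthonormal expansion of \<open>p\<close>, evaluated at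
    \<open>z\<close>.\<close>
  have "ip (kernel_poly z) p = (\<Sum>j<N. cnj (poly (\<phi> j) z) * cnj (ip p (\<phi> j)))"
    by (simp add: kernel_poly_def ip_sum_left ip_smult_left ip_cnj)
  then have "ip p (kernel_poly z) = (\<Sum>j<N. poly (\<phi> j) z * ip p (\<phi> j))"
    by (simp flip: ip_cnj[of "kernel_poly z" p])
  also have "\<dots> = poly p z"
    by (subst (2) poly_expansion[OF assms]) (simp add: poly_sum mult.commute)
  finally show ?thesis .
qed

text \<open>For \<open>N = 0\<close> the sum \<open>cd_kernel\<close> is empty while
  \<open>poly_space\<close> still contains the constants, so \<open>1 \<le> N\<close> is
  essential.\<close>

lemma repr_kernel_eq:
  assumes "1 \<le> N"
  shows "repr_kernel \<mu> N = cd_kernel"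
proof (rule repr_kernel_eqI)
  have "(\<lambda>w. cd_kernel w z) \<in> poly_space N" for z
    unfolding poly_space_def using degree_kernel_poly[of z]
    by (intro image_eqI[of _ _ "kernel_poly z"]) (auto simp: poly_kernel_poly)
  moreover have "p z = (\<integral>w. p w * cnj (cd_kernel w z) \<partial>\<mu>)" if "p \<in> poly_space N" for p z
    using that assms ip_kernel_poly[of _ z] by (auto simp: poly_space_def ip_def poly_kernel_poly)
  ultimately show "is_reproducing_kernel \<mu> N cd_kernel"
    by (auto simp: is_reproducing_kernel_def)
qed

lemma
  assumes "1 \<le> N"
  shows integrable_kernel_mult: "integrable \<mu> (\<lambda>y. cd_kernel y w * cd_kernel z y)"
    and integral_kernel_mult: "(\<integral>y. cd_kernel y w * cd_kernel z y \<partial>\<mu>) = cd_kernel z w"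
proof -
  \<comment> \<open>By Hermitian symmetry the integral is the inner product of two sections; the
    reproducing property applied to the section at \<open>w\<close> then evaluates it at
    \<open>z\<close>.\<close>
  have eq: "cd_kernel y w * cd_kernel z y = poly (kernel_poly w) y * cnj (poly (kernel_poly z) y)" for y
    by (simp add: poly_kernel_poly cnj_kernel)
  show "integrable \<mu> (\<lambda>y. cd_kernel y w * cd_kernel z y)"
    unfolding eq by (rule integrable_poly)
  have "degree (kernel_poly w) < N"
    using degree_kernel_poly[of w] assms by simp
  then show "(\<integral>y. cd_kernel y w * cd_kernel z y \<partial>\<mu>) = cd_kernel z w"
    unfolding eq ip_def[symmetric] by (simp add: ip_kernel_poly poly_kernel_poly)
qed

lemma integrable_kernel_diag: "integrable \<mu> (\<lambda>y. cd_kernel y y)"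
  unfolding cd_kernel_def by (intro Bochner_Integration.integrable_sum integrable_poly)

lemma integral_kernel_diag: "(\<integral>y. cd_kernel y y \<partial>\<mu>) = of_nat N"
  unfolding cd_kernel_def
  by (simp add: Bochner_Integration.integral_sum integrable_poly orth flip: ip_def)

section \<open>Kernel determinants: integrating out one variable, and positivity\<close>

definition kdet :: "nat \<Rightarrow> (nat \<Rightarrow> complex) \<Rightarrow> complex" where
  "kdet m z = Determinant.det (Matrix.mat m m (\<lambda>(j, k). cd_kernel (z j) (z k)))"

lemma kdet_0: "kdet 0 z = 1"
  by (simp add: kdet_def)

text \<open>Isolates the dependence on the new point \<open>y\<close>: it enters only through the
  kernel values shown, since updating coordinate \<open>m\<close> leaves the block with indices
  below \<open>m\<close> unchanged.\<close>

lemma kdet_Suc: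
  defines "B \<equiv> \<lambda>z m. Matrix.mat m m (\<lambda>(j, k). cd_kernel (z j) (z k))"
  shows "kdet (Suc m) (z(m := y)) = cd_kernel y y * kdet m z
    - (\<Sum>k<m. \<Sum>j<m. cd_kernel y (z k) * cd_kernel (z j) y * cofactor (B z m) j k)"
proof -
  have "Matrix.mat m m (\<lambda>(i, j). B (z(m := y)) (Suc m) $$ (i, j)) = B z m"
    by (rule eq_matI) (auto simp: B_def)
  then show ?thesis
    using det_bordered[of "B (z(m := y)) (Suc m)" m]
    by (simp add: kdet_def B_def)
qed

lemma
  assumes "1 \<le> N"
  shows integrable_kdet_Suc: "integrable \<mu> (\<lambda>y. kdet (Suc m) (z(m := y)))"
    and integral_kdet_Suc:
      "(\<integral>y. kdet (Suc m) (z(m := y)) \<partial>\<mu>) = (of_nat N - of_nat m) * kdet m z"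
proof -
  let ?B = "Matrix.mat m m (\<lambda>(j, k). cd_kernel (z j) (z k))"
  note int = integrable_kernel_mult[OF assms] integrable_kernel_diag
  show "integrable \<mu> (\<lambda>y. kdet (Suc m) (z(m := y)))"
    unfolding kdet_Suc
    by (intro Bochner_Integration.integrable_diff Bochner_Integration.integrable_sum
        integrable_mult_left int)
  \<comment> \<open>After integration the border products become the entries of column
    \<open>k\<close>, so each of the m columns contributes one Laplace expansion of
    \<open>kdet m z\<close>. The diagonal term contributes N copies, which leaves the factor N -
    m.\<close>
  have "(\<Sum>j<m. cd_kernel (z j) (z k) * cofactor ?B j k) = kdet m z" if "k < m" for k
    using laplace_expansion_column[of ?B m k] that by (simp add: kdet_def)
  then show "(\<integral>y. kdet (Suc m) (z(m := y)) \<partial>\<mu>) = (of_nat N - of_nat m) * kdet m z"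
    unfolding kdet_Suc
    by (simp add: int integral_kernel_mult[OF assms] integral_kernel_diag left_diff_distrib)
qed

text \<open>The ratio of \<open>kdet N\<close> to the squared modulus of the Vandermonde product. It
  equals N!/Z_N, as \<open>partition_fn_eq\<close> shows.\<close>

definition norm_const :: real where
  "norm_const = (\<Prod>j<N. (cmod (coeff (\<phi> j) j))\<^sup>2)"

lemma norm_const_pos: "0 < norm_const"
  unfolding norm_const_def using leading_nonzero by (intro prod_pos) auto

lemma kdet_full: "kdet N z = of_real (norm_const * (cmod (vandermonde N z))\<^sup>2)"
  unfolding kdet_def cd_kernel_def norm_const_def by (rule det_gram_square) (simp add: deg)

text \<open>Positivity descends from the full determinant, a squared modulus, by integrating out
  variables.\<close>

lemma kdet_nonneg:
  assumes "m \<le> N"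
  shows "kdet m z = of_real (Re (kdet m z)) \<and> 0 \<le> Re (kdet m z)"
  using assms
proof (induction m arbitrary: z rule: inc_induct)
  case base
  show ?case
    using norm_const_pos by (simp add: kdet_full)
next
  case (step m)
  let ?f = "\<lambda>y. Re (kdet (Suc m) (z(m := y)))"
  have "(\<integral>y. complex_of_real (?f y) \<partial>\<mu>) = (of_nat N - of_nat m) * kdet m z"
    using integral_kdet_Suc[of m z] step.hyps unfolding step.IH[THEN conjunct1, symmetric] by simp
  then have "of_real (\<integral>y. ?f y \<partial>\<mu>) = of_real (real N - real m) * kdet m z"
    by (simp only: integral_complex_of_real) simp
  \<comment> \<open>Here \<open>m < N\<close>, so the factor can be divided out and is positive;
    realness and sign pass from the integral to \<open>kdet m z\<close>.\<close>
  then have "kdet m z = of_real ((\<integral>y. ?f y \<partial>\<mu>) / (real N - real m))"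
    using step by (simp add: field_simps)
  moreover have "0 \<le> (\<integral>y. ?f y \<partial>\<mu>)"
    using step.IH by (intro Bochner_Integration.integral_nonneg) auto
  ultimately show ?case
    using step by simp
qed

section \<open>Nonnegative iterated integrals and the marginals\<close>

lemma nn_integral_kdet_Suc:
  assumes "m < N"
  shows "(\<integral>\<^sup>+y. ennreal (Re (kdet (Suc m) (z(m := y)))) \<partial>\<mu>)
    = ennreal (real (N - m) * Re (kdet m z))"
proof -
  have N: "1 \<le> N"
    using assms by simp
  have "(\<integral>\<^sup>+y. ennreal (Re (kdet (Suc m) (z(m := y)))) \<partial>\<mu>)
      = ennreal (\<integral>y. Re (kdet (Suc m) (z(m := y))) \<partial>\<mu>)"
    using kdet_nonneg[of "Suc m"] assms
    by (intro nn_integral_eq_integral integrable_Re integrable_kdet_Suc N) auto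
  also have "(\<integral>y. Re (kdet (Suc m) (z(m := y))) \<partial>\<mu>) = Re ((of_nat N - of_nat m) * kdet m z)"
    by (simp only: integral_Re integrable_kdet_Suc[OF N] integral_kdet_Suc[OF N])
  also have "\<dots> = real (N - m) * Re (kdet m z)"
    using assms by simp
  finally show ?thesis .
qed

lemma borel_measurable_component:
  "i \<in> I \<Longrightarrow> (\<lambda>z. z i) \<in> borel_measurable (\<Pi>\<^sub>M i\<in>I. \<mu>)"
  using measurable_component_singleton[of i I "\<lambda>_. \<mu>"] by (simp cong: measurable_cong_sets)

lemma borel_measurable_kdet:
  assumes "{..<m} \<subseteq> I"
  shows "kdet m \<in> borel_measurable (\<Pi>\<^sub>M i\<in>I. \<mu>)"
proof -
  have poly: "(\<lambda>z. poly p (z i)) \<in> borel_measurable (\<Pi>\<^sub>M i\<in>I. \<mu>)" if "i < m" for i p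
    by (rule measurable_compose[OF measurable_component_singleton[where M = "\<lambda>_. \<mu>"] borel_measurable_poly])
      (use that assms in auto)
  have cnj: "(\<lambda>z. cnj (f z)) \<in> borel_measurable M" if "f \<in> borel_measurable M" for f and M :: "'b measure"
    using that by (intro measurable_compose[OF that] borel_measurable_continuous_onI continuous_intros)
  \<comment> \<open>The Leibniz formula writes the determinant as finite sums and products of
    measurable functions of the coordinates.\<close>
  have "kdet m = (\<lambda>z. \<Sum>p | p permutes {0..<m}. signof p *
      (\<Prod>i = 0..<m. \<Sum>l<N. poly (\<phi> l) (z i) * cnj (poly (\<phi> l) (z (p i)))))"
    by (rule ext, unfold kdet_def cd_kernel_def, subst det_def'[of _ m])
      (auto intro!: sum.cong arg_cong2[where f = "(*)"] prod.cong dest: permutes_in_image)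
  also have "\<dots> \<in> borel_measurable (\<Pi>\<^sub>M i\<in>I. \<mu>)"
    by (intro borel_measurable_sum borel_measurable_times borel_measurable_const
        borel_measurable_prod cnj poly) (auto dest: permutes_in_image)
  finally show ?thesis .
qed

text \<open>By Tonelli, each variable integrated out contributes a finite factor, down to the empty
  product space of total mass 1.\<close>

lemma nn_integral_kdet_finite:
  assumes "m \<le> N"
  shows "(\<integral>\<^sup>+z. ennreal (Re (kdet m z)) \<partial>(\<Pi>\<^sub>M i\<in>{..<m}. \<mu>)) < \<infinity>"
  using assms
proof (induction m)
  case 0
  show ?case
    by (simp add: kdet_0 PiM_empty)
next
  case (Suc m)
  have [measurable]: "kdet (Suc m) \<in> borel_measurable (\<Pi>\<^sub>M i\<in>insert m {..<m}. \<mu>)"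
    by (rule borel_measurable_kdet) auto
  have [measurable]: "kdet m \<in> borel_measurable (\<Pi>\<^sub>M i\<in>{..<m}. \<mu>)"
    by (rule borel_measurable_kdet) auto
  have "(\<integral>\<^sup>+z. ennreal (Re (kdet (Suc m) z)) \<partial>(\<Pi>\<^sub>M i\<in>{..<Suc m}. \<mu>))
    = (\<integral>\<^sup>+z. (\<integral>\<^sup>+y. ennreal (Re (kdet (Suc m) (z(m := y)))) \<partial>\<mu>) \<partial>(\<Pi>\<^sub>M i\<in>{..<m}. \<mu>))"
    unfolding lessThan_Suc by (rule prod.product_nn_integral_insert) auto
  also have "\<dots> = ennreal (real (N - m)) * (\<integral>\<^sup>+z. ennreal (Re (kdet m z)) \<partial>(\<Pi>\<^sub>M i\<in>{..<m}. \<mu>))"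
    using Suc.prems by (simp add: nn_integral_kdet_Suc ennreal_mult' nn_integral_cmult)
  also have "\<dots> < \<infinity>"
    using Suc by (simp add: ennreal_mult_less_top)
  finally show ?case .
qed

text \<open>Descending induction from \<open>m = N\<close>, where \<open>kdet_full\<close> applies.
  Integrating out coordinate \<open>m\<close> brings a factor N - m, and these factors accumulate to
  (N - m)!.\<close>

lemma nn_integral_vandermonde_marginal:
  assumes "m \<le> N"
  shows "(\<integral>\<^sup>+w. ennreal ((cmod (vandermonde N (merge {..<m} {m..<N} (z, w))))\<^sup>2)
      \<partial>(\<Pi>\<^sub>M i\<in>{m..<N}. \<mu>)) = ennreal (fact (N - m) * Re (kdet m z) / norm_const)"
  using assms
proof (induction m arbitrary: z rule: inc_induct)
  case base
  have "vandermonde N (merge {..<N} {} (z, w)) = vandermonde N z" for w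
    by (rule vandermonde_cong) (simp add: merge_def)
  then show ?case
    using norm_const_pos by (simp add: PiM_empty kdet_full)
next
  case (step m)
  let ?v = "\<lambda>m z w. ennreal ((cmod (vandermonde N (merge {..<m} {m..<N} (z, w))))\<^sup>2)"
  have ins: "{m..<N} = insert m {Suc m..<N}"
    using step by auto
  have meas: "(\<lambda>w. vandermonde N (merge {..<m} {m..<N} (z, w))) \<in> borel_measurable (\<Pi>\<^sub>M i\<in>{m..<N}. \<mu>)"
  proof (rule borel_measurable_vandermonde)
    fix i assume "i < N"
    then show "(\<lambda>w. merge {..<m} {m..<N} (z, w) i) \<in> borel_measurable (\<Pi>\<^sub>M i\<in>{m..<N}. \<mu>)"
      by (cases "i < m") (auto simp: merge_def intro!: borel_measurable_component)
  qed
  \<comment> \<open>Moves coordinate \<open>m\<close> from the integrated block to the fixed one.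
    With \<open>y\<close> as the outermost variable, the inner integral is the induction hypothesis
    at \<open>z(m := y)\<close>.\<close>
  have upd: "?v m z (w(m := y)) = ?v (Suc m) (z(m := y)) w" for w y
    by (intro arg_cong[where f = "\<lambda>x. ennreal ((cmod x)\<^sup>2)"] vandermonde_cong)
      (auto simp: merge_def)
  have "(\<integral>\<^sup>+w. ?v m z w \<partial>(\<Pi>\<^sub>M i\<in>{m..<N}. \<mu>))
    = (\<integral>\<^sup>+y. (\<integral>\<^sup>+w. ?v m z (w(m := y)) \<partial>(\<Pi>\<^sub>M i\<in>{Suc m..<N}. \<mu>)) \<partial>\<mu>)"
    unfolding ins
    by (rule prod.product_nn_integral_insert_rev) (use meas in \<open>auto simp flip: ins\<close>)
  also have "\<dots> = (\<integral>\<^sup>+y. ennreal (fact (N - Suc m) / norm_const) * ennreal (Re (kdet (Suc m) (z(m := y)))) \<partial>\<mu>)"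
    unfolding upd step.IH using norm_const_pos step
    by (intro nn_integral_cong) (simp flip: ennreal_mult')
  also have "\<dots> = ennreal (fact (N - Suc m) / norm_const) * ennreal (real (N - m) * Re (kdet m z))"
    using step integrable_kdet_Suc[of m z]
    by (subst nn_integral_cmult) (auto simp: nn_integral_kdet_Suc)
  also have "\<dots> = ennreal (fact (N - Suc m) / norm_const * (real (N - m) * Re (kdet m z)))"
    using norm_const_pos by (simp flip: ennreal_mult')
  also have "fact (N - Suc m) / norm_const * (real (N - m) * Re (kdet m z))
      = fact (N - m) * Re (kdet m z) / norm_const"
    using step by (simp add: fact_reduce[of "N - m"] Suc_diff_Suc)
  finally show ?case .
qed

text \<open>The marginal with no fixed variable, where the determinant is the empty one, equal to
  1.\<close>

lemma partition_fn_eq: "partition_fn \<mu> N = ennreal (fact N / norm_const)"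
proof -
  have "vandermonde N (merge {} {..<N} (z, w)) = vandermonde N w" for z w
    by (rule vandermonde_cong) (simp add: merge_def)
  then show ?thesis
    using nn_integral_vandermonde_marginal[of 0]
    by (simp add: partition_fn_def kdet_0 atLeast0LessThan)
qed

lemma correlation_measure_eq:
  assumes "n \<le> N"
  shows "correlation_measure \<mu> N n = density (\<Pi>\<^sub>M i\<in>{..<n}. \<mu>) (\<lambda>z. ennreal (Re (kdet n z)))"
proof -
  \<comment> \<open>Inverting Z_N is harmless because it is positive and finite; all factorials and
    \<open>norm_const\<close> then cancel.\<close>
  have "1 / ennreal (fact N / norm_const) = ennreal (norm_const / fact N)"
    using norm_const_pos divide_ennreal[of 1 "fact N / norm_const"] by simp
  then have "ennreal (fact N / fact (N - n)) * (1 / partition_fn \<mu> N) *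
      ennreal (fact (N - n) * Re (kdet n z) / norm_const) = ennreal (Re (kdet n z))" for z
    using norm_const_pos
    by (simp add: partition_fn_eq flip: ennreal_mult')
  then show ?thesis
    by (simp add: correlation_measure_def nn_integral_vandermonde_marginal[OF assms])
qed

end

theorem theorem2p2:
  fixes \<mu> :: "complex measure" and n N :: nat
  assumes "sets \<mu> = sets borel"
    and "finite_measure \<mu>"
    and "infinite (measure_support \<mu>)"
    and "\<And>m::nat. 0 < (\<integral>\<^sup>+z. ennreal (cmod z ^ (2 * m)) \<partial>\<mu>)"
    and "\<And>m::nat. (\<integral>\<^sup>+z. ennreal (cmod z ^ (2 * m)) \<partial>\<mu>) < \<infinity>"
    and "1 \<le> n" and "n \<le> N"
  shows "has_complex_density (correlation_measure \<mu> N n) (\<Pi>\<^sub>M i\<in>{..<n}. \<mu>)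
           (\<lambda>z. Determinant.det (Matrix.mat n n (\<lambda>(j, k). repr_kernel \<mu> N (z j) (z k))))"
proof -
  interpret moment_measure \<mu>
    using assms by (simp add: moment_measure_def moment_measure_axioms_def)
  obtain \<phi> where "\<forall>j<N. degree (\<phi> j) = j"
    "\<forall>i<N. \<forall>j<N. ip (\<phi> i) (\<phi> j) = (if i = j then 1 else 0)"
    using ex_orthonormal by blast
  then interpret orthonormal_polys \<mu> \<phi> N
    by unfold_locales auto
  have "has_complex_density (density (\<Pi>\<^sub>M i\<in>{..<n}. \<mu>) (\<lambda>z. ennreal (Re (kdet n z))))
      (\<Pi>\<^sub>M i\<in>{..<n}. \<mu>) (\<lambda>z. complex_of_real (Re (kdet n z)))"
    using borel_measurable_kdet[of n "{..<n}"] kdet_nonneg[OF \<open>n \<le> N\<close>] nn_integral_kdet_finite[OF \<open>n \<le> N\<close>]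
    by (intro has_complex_density_density) auto
  \<comment> \<open>Realness of the determinant turns the density by its real part into the complex
    density claimed.\<close>
  moreover have "complex_of_real (Re (kdet n z)) = kdet n z" for z
    using kdet_nonneg[OF \<open>n \<le> N\<close>] by simp
  ultimately show ?thesis
    using assms by (simp add: correlation_measure_eq repr_kernel_eq kdet_def)
qed

end
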